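(* Let $n\ge2$ and let $K\subseteq\mathbb{R}^n$ be convex with nonempty interior. For every rational $q\notin\{0,1\}$ there are $\mathcal{L}_{\mathrm{B}}$-formulas $\mathrm{CR}_q(a,b,c,d)$ and $\mathrm{CR}_{>q}(a,b,c,d)$ such that, for all collinear quadruples $a,b,c,d$ of pairwise distinct points of $\operatorname{int}K$, $$K\models\mathrm{CR}_q(a,b,c,d)\iff(a,b;c,d)=q,\qquad K\models\mathrm{CR}_{>q}(a,b,c,d)\iff(a,b;c,d)>q.$$
   Context: $\mathcal{L}_{\mathrm{B}}$ is the first-order language with a single ternary relation symbol $B$. A convex set $K\subseteq\mathbb{R}^n$ is an $\mathcal{L}_{\mathrm{B}}$-structure with universe $K$, where $B(a,x,b)$ holds iff $x\in[a,b]$ (the closed segment). The formulas are without parameters. Cross-ratio: for distinct collinear points $a,b,c,d$ with parameters $\alpha,\beta,\gamma,\delta$ under an affine parametrization of their common line, $(a,b;c,d)=\frac{(\gamma-\alpha)(\delta-\beta)}{(\gamma-\beta)(\delta-\alpha)}$. *)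

theory Defs
  imports "HOL-Analysis.Analysis"
begin

text \<open>First-order formulas (with equality) over one ternary relation symbol, with variables named
  by natural numbers; there are no constants, so formulas carry no parameters.  Disjunction,
  implication and universal quantification are expressible by the connectives below.\<close>

datatype fm =
    Eq nat nat
  | B nat nat nat
  | Neg fm
  | Conj fm fm
  | Ex nat fm

fun fv :: "fm \<Rightarrow> nat set" where
  "fv (Eq i j) = {i, j}"
| "fv (B i j k) = {i, j, k}"
| "fv (Neg p) = fv p"
| "fv (Conj p q) = fv p \<union> fv q"
| "fv (Ex i p) = fv p - {i}"

text \<open>Satisfaction in the structure with universe \<open>U\<close> and interpretation \<open>R\<close> of the relation symbol,
  under the assignment \<open>e\<close>.\<close>

fun sat :: "'a set \<Rightarrow> ('a \<Rightarrow> 'a \<Rightarrow> 'a \<Rightarrow> bool) \<Rightarrow> (nat \<Rightarrow> 'a) \<Rightarrow> fm \<Rightarrow> bool" where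
  "sat U R e (Eq i j) \<longleftrightarrow> e i = e j"
| "sat U R e (B i j k) \<longleftrightarrow> R (e i) (e j) (e k)"
| "sat U R e (Neg p) \<longleftrightarrow> \<not> sat U R e p"
| "sat U R e (Conj p q) \<longleftrightarrow> sat U R e p \<and> sat U R e q"
| "sat U R e (Ex i p) \<longleftrightarrow> (\<exists>x\<in>U. sat U R (e(i := x)) p)"

lemma sat_cong_fv:
  "(\<And>i. i \<in> fv p \<Longrightarrow> e i = e' i) \<Longrightarrow> sat U R e p \<longleftrightarrow> sat U R e' p"
proof (induction p arbitrary: e e')
  case (Ex i p)
  have "sat U R (e(i := x)) p \<longleftrightarrow> sat U R (e'(i := x)) p" for x
    using Ex.prems by (intro Ex.IH) auto
  then show ?case by simp
next
  case (Neg p)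
  then show ?case by (metis fv.simps(3) sat.simps(3))
next
  case (Conj p q)
  then show ?case by (metis Un_iff fv.simps(4) sat.simps(4))
qed auto

definition betw :: "'a::real_vector \<Rightarrow> 'a \<Rightarrow> 'a \<Rightarrow> bool" where
  "betw a x b \<longleftrightarrow> x \<in> closed_segment a b"

text \<open>\<open>holds4 K p a b c d\<close> is \<open>K \<Turnstile> p(a,b,c,d)\<close>, where the free variables of \<open>p\<close> are among
  0, 1, 2, 3, in this order.  The values of the other variables are then irrelevant
  (lemma \<open>sat_cong_fv\<close>).\<close>

definition holds4 :: "'a::real_vector set \<Rightarrow> fm \<Rightarrow> 'a \<Rightarrow> 'a \<Rightarrow> 'a \<Rightarrow> 'a \<Rightarrow> bool" where
  "holds4 K p a b c d \<longleftrightarrow> sat K betw ((\<lambda>_. a)(1 := b, 2 := c, 3 := d)) p"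

text \<open>Only meaningful for pairwise distinct collinear points; then the value does not depend on the
  affine parametrization \<open>t \<mapsto> u + t v\<close> of the common line (lemma \<open>cross_ratio_eqI\<close>).\<close>

definition cross_ratio :: "'a::real_vector \<Rightarrow> 'a \<Rightarrow> 'a \<Rightarrow> 'a \<Rightarrow> real" where
  "cross_ratio a b c d =
     (THE r. \<exists>u v \<alpha> \<beta> \<gamma> \<delta>. v \<noteq> 0 \<and>
        a = u + \<alpha> *\<^sub>R v \<and> b = u + \<beta> *\<^sub>R v \<and> c = u + \<gamma> *\<^sub>R v \<and> d = u + \<delta> *\<^sub>R v \<and>
        r = ((\<gamma> - \<alpha>) * (\<delta> - \<beta>)) / ((\<gamma> - \<beta>) * (\<delta> - \<alpha>)))"

lemma cross_ratio_eqI: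
  fixes a b c d u v :: "'a::real_vector"
  assumes dist: "distinct [a, b, c, d]" and v: "v \<noteq> 0"
    and a: "a = u + \<alpha> *\<^sub>R v" and b: "b = u + \<beta> *\<^sub>R v"
    and c: "c = u + \<gamma> *\<^sub>R v" and d: "d = u + \<delta> *\<^sub>R v"
  shows "cross_ratio a b c d = ((\<gamma> - \<alpha>) * (\<delta> - \<beta>)) / ((\<gamma> - \<beta>) * (\<delta> - \<alpha>))"
  unfolding cross_ratio_def
proof (rule the_equality)
  show "\<exists>u v \<alpha>' \<beta>' \<gamma>' \<delta>'. v \<noteq> 0 \<and> a = u + \<alpha>' *\<^sub>R v \<and> b = u + \<beta>' *\<^sub>R v \<and> c = u + \<gamma>' *\<^sub>R v
      \<and> d = u + \<delta>' *\<^sub>R v \<and> ((\<gamma> - \<alpha>) * (\<delta> - \<beta>)) / ((\<gamma> - \<beta>) * (\<delta> - \<alpha>))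
         = ((\<gamma>' - \<alpha>') * (\<delta>' - \<beta>')) / ((\<gamma>' - \<beta>') * (\<delta>' - \<alpha>'))"
    using v a b c d by blast
next
  fix r
  assume "\<exists>u v \<alpha> \<beta> \<gamma> \<delta>. v \<noteq> 0 \<and>
        a = u + \<alpha> *\<^sub>R v \<and> b = u + \<beta> *\<^sub>R v \<and> c = u + \<gamma> *\<^sub>R v \<and> d = u + \<delta> *\<^sub>R v \<and>
        r = ((\<gamma> - \<alpha>) * (\<delta> - \<beta>)) / ((\<gamma> - \<beta>) * (\<delta> - \<alpha>))"
  then obtain u' v' \<alpha>' \<beta>' \<gamma>' \<delta>' where v': "v' \<noteq> 0"
    and a': "a = u' + \<alpha>' *\<^sub>R v'" and b': "b = u' + \<beta>' *\<^sub>R v'"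
    and c': "c = u' + \<gamma>' *\<^sub>R v'" and d': "d = u' + \<delta>' *\<^sub>R v'"
    and r: "r = ((\<gamma>' - \<alpha>') * (\<delta>' - \<beta>')) / ((\<gamma>' - \<beta>') * (\<delta>' - \<alpha>'))" by blast
  have ba: "b - a = (\<beta> - \<alpha>) *\<^sub>R v"
    unfolding a b by (simp add: algebra_simps)
  have ba': "b - a = (\<beta>' - \<alpha>') *\<^sub>R v'"
    unfolding a' b' by (simp add: algebra_simps)
  have "\<beta>' \<noteq> \<alpha>'" using dist a' b' by auto
  define k where "k = (\<beta> - \<alpha>) / (\<beta>' - \<alpha>')"
  have "(\<beta>' - \<alpha>') *\<^sub>R v' = (\<beta>' - \<alpha>') *\<^sub>R (k *\<^sub>R v)"
    using ba unfolding ba' using \<open>\<beta>' \<noteq> \<alpha>'\<close> by (simp add: k_def)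
  then have vk: "v' = k *\<^sub>R v"
    using \<open>\<beta>' \<noteq> \<alpha>'\<close> by (metis right_minus_eq scaleR_left_imp_eq)
  then have k: "k \<noteq> 0" using v' by auto
  have diff: "s - t = k * (s' - t')"
    if "x = u + s *\<^sub>R v" "y = u + t *\<^sub>R v" "x = u' + s' *\<^sub>R v'" "y = u' + t' *\<^sub>R v'"
    for x y s t s' t'
  proof -
    have "x - y = (s - t) *\<^sub>R v" using that(1,2) by (simp add: algebra_simps)
    moreover have "x - y = (s' - t') *\<^sub>R v'" using that(3,4) by (simp add: algebra_simps)
    ultimately have "(s - t) *\<^sub>R v = (k * (s' - t')) *\<^sub>R v" by (metis mult.commute scaleR_scaleR vk)
    then show ?thesis using v by auto
  qed
  show "r = ((\<gamma> - \<alpha>) * (\<delta> - \<beta>)) / ((\<gamma> - \<beta>) * (\<delta> - \<alpha>))"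
    unfolding r diff[OF c a c' a'] diff[OF d b d' b'] diff[OF c b c' b'] diff[OF d a d' a']
    using k by simp
qed

end

theory Submission
  imports Defs
begin

text \<open>If \<open>z\<close> is an endpoint of the segment spanned by the four points, send it to infinity by a
  projective coordinate on the line.  Harmonic conjugation with respect to \<open>z\<close> then becomes the
  midpoint relation, and it is definable inside \<open>K\<close> by a complete quadrilateral that stays in a
  small triangle over the segment.  Iterated midpoints define arithmetic progressions, and a
  cross-ratio with \<open>a = z\<close> is the ratio \<open>(\<delta> - \<beta>) / (\<gamma> - \<beta>)\<close>; it equals \<open>m / n\<close> iff the
  three other points occupy the appropriate places of a common progression.  The symmetries of the
  cross-ratio under the Klein four-group move an endpoint to the first place.\<close>

section \<open>Betweenness on a line\<close>

lemma betw_line_iff: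
  fixes u v :: "'a::real_vector"
  assumes "v \<noteq> 0"
  shows "betw (u + \<alpha> *\<^sub>R v) (u + \<beta> *\<^sub>R v) (u + \<gamma> *\<^sub>R v) \<longleftrightarrow> \<alpha> \<le> \<beta> \<and> \<beta> \<le> \<gamma> \<or> \<gamma> \<le> \<beta> \<and> \<beta> \<le> \<alpha>"
proof -
  have "u + \<beta> *\<^sub>R v = (1 - s) *\<^sub>R (u + \<alpha> *\<^sub>R v) + s *\<^sub>R (u + \<gamma> *\<^sub>R v) \<longleftrightarrow> \<beta> = (1 - s) * \<alpha> + s * \<gamma>" for s
  proof -
    have "(1 - s) *\<^sub>R (u + \<alpha> *\<^sub>R v) + s *\<^sub>R (u + \<gamma> *\<^sub>R v) = u + ((1 - s) * \<alpha> + s * \<gamma>) *\<^sub>R v"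
      by (simp add: algebra_simps)
    then show ?thesis using assms by simp
  qed
  then have "betw (u + \<alpha> *\<^sub>R v) (u + \<beta> *\<^sub>R v) (u + \<gamma> *\<^sub>R v) \<longleftrightarrow> \<beta> \<in> closed_segment \<alpha> \<gamma>"
    by (simp add: betw_def in_segment)
  then show ?thesis by (auto simp: closed_segment_eq_real_ivl)
qed

lemma betwE:
  assumes "betw a x b"
  obtains s where "0 \<le> s" "s \<le> 1" "x = a + s *\<^sub>R (b - a)"
proof -
  from assms obtain s where "0 \<le> s" "s \<le> 1" "x = (1 - s) *\<^sub>R a + s *\<^sub>R b"
    by (auto simp: betw_def in_segment)
  then show thesis by (intro that[of s]) (auto simp: algebra_simps)
qed

lemma betwI:
  assumes "0 \<le> s" "s \<le> 1" "x = a + s *\<^sub>R (b - a)"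
  shows "betw a x b"
  unfolding betw_def in_segment using assms
  by (intro exI[of _ s]) (auto simp: algebra_simps)

lemma convex_betw: "convex K \<Longrightarrow> a \<in> K \<Longrightarrow> b \<in> K \<Longrightarrow> betw a x b \<Longrightarrow> x \<in> K"
  unfolding betw_def using closed_segment_subset by blast

text \<open>The half-line ending at \<open>z\<close>, in the projective coordinate that sends \<open>z\<close> to infinity.\<close>

definition ray_pt :: "'a::real_vector \<Rightarrow> 'a \<Rightarrow> real \<Rightarrow> 'a" where
  "ray_pt z v g = z + (- (1 / g)) *\<^sub>R v"

text \<open>Division by zero gives 0, so the parameter 0 yields \<open>z\<close> itself and
  injectivity holds on all reals.\<close>

lemma ray_pt_eq_iff [simp]: "v \<noteq> 0 \<Longrightarrow> ray_pt z v g = ray_pt z v h \<longleftrightarrow> g = h"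
  by (cases "g = 0"; cases "h = 0") (auto simp: ray_pt_def)

lemma ray_pt_neq_end [simp]: "v \<noteq> 0 \<Longrightarrow> 0 < g \<Longrightarrow> ray_pt z v g \<noteq> z"
  by (auto simp: ray_pt_def)

text \<open>\<open>- (1 / g)\<close> increases with \<open>g\<close> on the positive reals, so the
  change of coordinate keeps the order; growing parameters approach \<open>z\<close>.\<close>

lemma betw_ray_pt_iff:
  assumes "v \<noteq> 0" "0 < a" "0 < b" "0 < c"
  shows "betw (ray_pt z v a) (ray_pt z v b) (ray_pt z v c) \<longleftrightarrow> a \<le> b \<and> b \<le> c \<or> c \<le> b \<and> b \<le> a"
  unfolding ray_pt_def using assms by (subst betw_line_iff) (auto simp: field_simps)

lemma betw_ray_pt_end_iff:
  assumes "v \<noteq> 0" "0 < a" "0 < b"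
  shows "betw (ray_pt z v a) (ray_pt z v b) z \<longleftrightarrow> a \<le> b"
  unfolding ray_pt_def using assms betw_line_iff[of v z "- (1 / a)" "- (1 / b)" 0]
  by (auto simp: field_simps)

lemma betw_ray_pt_endE:
  assumes "v \<noteq> 0" "0 < a" "betw (ray_pt z v a) x z" "x \<noteq> z"
  obtains b where "a \<le> b" "x = ray_pt z v b"
proof -
  obtain s where s: "0 \<le> s" "s \<le> 1" "x = ray_pt z v a + s *\<^sub>R (z - ray_pt z v a)"
    using assms(3) by (rule betwE)
  have "s \<noteq> 1" using s(3) assms(4) by auto
  \<comment> \<open>Going the fraction \<open>s\<close> of the way to \<open>z\<close> shrinks the
    offset \<open>1 / a\<close> to \<open>(1 - s) / a\<close>, whose reciprocal is the new
    parameter.\<close>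
  then have "a \<le> a / (1 - s)" using s assms by (simp add: field_simps)
  moreover have "x = ray_pt z v (a / (1 - s))"
    using s(3) by (simp add: ray_pt_def diff_divide_distrib algebra_simps)
  ultimately show thesis by (rule that)
qed

section \<open>Harmonic quadruples\<close>

text \<open>Complete quadrilateral with diagonal points \<open>c\<close>, \<open>d\<close>: all its points lie in the triangle
  \<open>c d P\<close>, which fits into \<open>K\<close> if \<open>P\<close> is close to \<open>y\<close>.\<close>

definition harmonic :: "'a::real_vector set \<Rightarrow> 'a \<Rightarrow> 'a \<Rightarrow> 'a \<Rightarrow> 'a \<Rightarrow> bool" where
  "harmonic K c y d z \<longleftrightarrow> betw c y d \<and> betw y d z \<and> c \<noteq> y \<and> y \<noteq> d \<and> d \<noteq> z \<and>
     (\<exists>P\<in>K. \<exists>R\<in>K. \<exists>Q\<in>K. \<exists>S\<in>K. \<not> betw c P d \<and> \<not> betw P c d \<and> \<not> betw c d P \<and>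
        betw y R P \<and> R \<noteq> y \<and> R \<noteq> P \<and> betw d Q P \<and> betw c S P \<and>
        betw c R Q \<and> betw d R S \<and> betw S Q z)"

text \<open>Take \<open>y\<close> as origin and \<open>v\<close>, \<open>P - y\<close> as axes:
  \<open>c = (-s, 0)\<close>, \<open>d = (t, 0)\<close>, \<open>z = (\<zeta>, 0)\<close>,
  \<open>P = (0, 1)\<close>, \<open>R = (0, \<rho>)\<close>, while \<open>\<eta>\<close> and
  \<open>\<mu>\<close> are the heights of \<open>Q\<close> on \<open>dP\<close> and of
  \<open>S\<close> on \<open>cP\<close>. The three groups of hypotheses put \<open>R\<close> on
  \<open>cQ\<close>, \<open>R\<close> on \<open>dS\<close> and \<open>Q\<close> on
  \<open>Sz\<close>. The conclusion is the harmonic relation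
  \<open>cy * dz = yd * cz\<close>.\<close>

lemma quadrilateral_arith:
  fixes s t \<zeta> \<rho> \<eta> \<mu> \<kappa> \<kappa>' \<nu> :: real
  assumes "0 < s" "0 < t" "\<rho> \<noteq> 0" "\<rho> \<noteq> 1"
    and 1: "- s + \<kappa> * (t * (1 - \<eta>) + s) = 0" "\<kappa> * \<eta> = \<rho>"
    and 2: "t + \<kappa>' * (- s * (1 - \<mu>) - t) = 0" "\<kappa>' * \<mu> = \<rho>"
    and 3: "t * (1 - \<eta>) = - s * (1 - \<mu>) + \<nu> * (\<zeta> + s * (1 - \<mu>))" "\<eta> = \<mu> + \<nu> * (0 - \<mu>)"
  shows "s * (\<zeta> - t) = t * (\<zeta> + s)"
proof -
  have nz: "\<kappa> \<noteq> 0" "\<mu> \<noteq> 0" "\<kappa>' \<noteq> 0" using 1 2 assms(3) by auto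
  \<comment> \<open>Comparing the heights of \<open>R\<close> on both lines eliminates
    \<open>\<nu>\<close>.\<close>
  have "\<kappa> * ((1 - \<nu>) * \<mu>) = \<kappa>' * \<mu>" using 1(2) 2(2) 3(2) by (simp add: algebra_simps)
  then have nu: "\<kappa> * (1 - \<nu>) = \<kappa>'" using nz by (simp add: mult.assoc[symmetric])
  have "\<kappa> * (s + t) = s + t * (\<kappa> * \<eta>)" "\<kappa>' * (s + t) = t + s * (\<kappa>' * \<mu>)"
    using 1(1) 2(1) by (auto simp: algebra_simps)
  then have k: "\<kappa> * (s + t) = s + t * \<rho>" "\<kappa>' * (s + t) = t + s * \<rho>"
    unfolding 1(2) 2(2) .
  have "\<kappa> * (t * (1 - \<eta>)) = - (\<kappa> * (1 - \<nu>)) * (s * (1 - \<mu>)) + (\<kappa> - \<kappa> * (1 - \<nu>)) * \<zeta>"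
    unfolding 3(1) by (simp add: algebra_simps)
  then have "s * (1 - \<kappa>) + t * (1 - \<kappa>') = (\<kappa> - \<kappa>') * \<zeta>"
    unfolding nu using 1(1) 2(1) by (simp add: algebra_simps)
  then have "(s + t) * (s * (1 - \<kappa>) + t * (1 - \<kappa>')) = (s + t) * ((\<kappa> - \<kappa>') * \<zeta>)" by simp
  then have "s * (s + t) - s * (\<kappa> * (s + t)) + t * (s + t) - t * (\<kappa>' * (s + t))
      = (\<kappa> * (s + t) - \<kappa>' * (s + t)) * \<zeta>"
    by (simp add: algebra_simps)
  \<comment> \<open>The factor \<open>1 - \<rho>\<close> cancels because \<open>R\<close> differs
    from \<open>P\<close>; the result no longer depends on the position of \<open>R\<close>.\<close>
  then have "(1 - \<rho>) * (2 * s * t) = (1 - \<rho>) * ((s - t) * \<zeta>)"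
    unfolding k by (simp add: algebra_simps)
  then have "2 * s * t = (s - t) * \<zeta>" using assms(4) by simp
  then show ?thesis by (simp add: algebra_simps)
qed

lemma harmonic_imp_midpoint:
  fixes z v :: "'a::real_vector"
  assumes v: "v \<noteq> 0" and pos: "0 < a" "0 < b" "0 < e"
    and h: "harmonic K (ray_pt z v a) (ray_pt z v b) (ray_pt z v e) z"
  shows "a < b" "2 * b = a + e"
proof -
  define c y d where "c = ray_pt z v a" and "y = ray_pt z v b" and "d = ray_pt z v e"
  note h' = h[folded c_def y_def d_def, unfolded harmonic_def]
  have "b < e" using h' pos v by (auto simp: y_def d_def betw_ray_pt_end_iff less_le)
  moreover from this show "a < b"
    using h' pos v by (auto simp: c_def y_def d_def betw_ray_pt_iff less_le)
  ultimately have lt: "a < b" "b < e" by auto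
  \<comment> \<open>Offsets of \<open>c\<close> (negated), \<open>d\<close> and \<open>z\<close>
    from \<open>y\<close> in the ordinary affine coordinate along \<open>v\<close>.\<close>
  define s t \<zeta> where "s = 1 / a - 1 / b" and "t = 1 / b - 1 / e" and "\<zeta> = 1 / b"
  have st: "0 < s" "0 < t" using lt pos by (auto simp: s_def t_def field_simps)
  have c: "c = y + (- s) *\<^sub>R v" and d: "d = y + t *\<^sub>R v" and z: "z = y + \<zeta> *\<^sub>R v"
    by (auto simp: c_def y_def d_def ray_pt_def s_def t_def \<zeta>_def algebra_simps)
  obtain P R Q S where nc: "\<not> betw c P d" "\<not> betw P c d" "\<not> betw c d P"
    and R: "R \<noteq> y" "R \<noteq> P" and b: "betw y R P" "betw d Q P" "betw c S P"
        "betw c R Q" "betw d R S" "betw S Q z" using h' by blast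
  define w where "w = P - y"
  have P: "P = y + w" by (simp add: w_def)
  \<comment> \<open>Of three collinear points one lies between the other two, so the three negated
    betweenness conditions put \<open>P\<close> off the line. Hence coordinates with respect to
    \<open>v\<close> and \<open>w\<close> are unique.\<close>
  have "w \<noteq> x *\<^sub>R v" for x
  proof
    assume "w = x *\<^sub>R v"
    then show False
      using nc v unfolding P c d by (simp add: betw_line_iff del: scaleR_minus_left) linarith
  qed
  then have ind: "x = x' \<and> r = r'" if "y + x *\<^sub>R v + r *\<^sub>R w = y + x' *\<^sub>R v + r' *\<^sub>R w" for x r x' r'
  proof -
    have eq: "(r - r') *\<^sub>R w = (x' - x) *\<^sub>R v" using that by (simp add: algebra_simps)
    have "r = r'"
    proof (rule ccontr)
      assume "r \<noteq> r'"
      then have "w = (1 / (r - r')) *\<^sub>R ((r - r') *\<^sub>R w)" by simp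
      then have "w = ((x' - x) / (r - r')) *\<^sub>R v" unfolding eq by simp
      then show False using \<open>\<And>x. w \<noteq> x *\<^sub>R v\<close> by blast
    qed
    then show ?thesis using eq v by simp
  qed
  obtain \<rho> where "R = y + \<rho> *\<^sub>R (P - y)" using b(1) by (rule betwE)
  then have r: "R = y + 0 *\<^sub>R v + \<rho> *\<^sub>R w" by (simp add: P)
  have rho: "\<rho> \<noteq> 0" "\<rho> \<noteq> 1" using R by (auto simp: r P)
  obtain \<eta> where "Q = d + \<eta> *\<^sub>R (P - d)" using b(2) by (rule betwE)
  then have q: "Q = y + (t * (1 - \<eta>)) *\<^sub>R v + \<eta> *\<^sub>R w" by (simp add: P d algebra_simps)
  obtain \<mu> where "S = c + \<mu> *\<^sub>R (P - c)" using b(3) by (rule betwE)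
  then have s: "S = y + (- s * (1 - \<mu>)) *\<^sub>R v + \<mu> *\<^sub>R w" by (simp add: P c algebra_simps)
  obtain \<kappa> where "R = c + \<kappa> *\<^sub>R (Q - c)" using b(4) by (rule betwE)
  then have "y + 0 *\<^sub>R v + \<rho> *\<^sub>R w = y + (- s + \<kappa> * (t * (1 - \<eta>) + s)) *\<^sub>R v + (\<kappa> * \<eta>) *\<^sub>R w"
    unfolding r q c by (simp add: algebra_simps)
  note 1 = ind[OF this]
  obtain \<kappa>' where "R = d + \<kappa>' *\<^sub>R (S - d)" using b(5) by (rule betwE)
  then have "y + 0 *\<^sub>R v + \<rho> *\<^sub>R w = y + (t + \<kappa>' * (- s * (1 - \<mu>) - t)) *\<^sub>R v + (\<kappa>' * \<mu>) *\<^sub>R w"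
    unfolding r s d by (simp add: algebra_simps)
  note 2 = ind[OF this]
  obtain \<nu> where "Q = S + \<nu> *\<^sub>R (z - S)" using b(6) by (rule betwE)
  then have "y + (t * (1 - \<eta>)) *\<^sub>R v + \<eta> *\<^sub>R w
      = y + (- s * (1 - \<mu>) + \<nu> * (\<zeta> + s * (1 - \<mu>))) *\<^sub>R v + (\<mu> + \<nu> * (0 - \<mu>)) *\<^sub>R w"
    unfolding q s z by (simp add: algebra_simps)
  note 3 = ind[OF this]
  have "s * (\<zeta> - t) = t * (\<zeta> + s)"
    using quadrilateral_arith[OF st rho 1[THEN conjunct1, symmetric] 1[THEN conjunct2, symmetric]
      2[THEN conjunct1, symmetric] 2[THEN conjunct2, symmetric] 3[THEN conjunct1] 3[THEN conjunct2]] .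
  \<comment> \<open>After substitution the two sides are \<open>(b - a) / (a * b * e)\<close> and
    \<open>(e - b) / (a * b * e)\<close>.\<close>
  then show "2 * b = a + e"
    using pos by (simp add: s_def t_def \<zeta>_def field_simps)
qed

text \<open>One explicit quadrilateral suffices. Its apex \<open>P\<close> lies off the line, which
  dimension 2 permits, and in a ball around the interior point \<open>y\<close>; convexity then puts
  the other vertices into \<open>K\<close>.\<close>

lemma midpoint_imp_harmonic:
  fixes z v :: "'a::euclidean_space"
  assumes dim: "2 \<le> DIM('a)" and K: "convex K" and v: "v \<noteq> 0" and pos: "0 < a"
    and ab: "a < b" and mid: "2 * b = a + e"
    and inK: "ray_pt z v a \<in> K" "ray_pt z v b \<in> interior K" "ray_pt z v e \<in> K"
  shows "harmonic K (ray_pt z v a) (ray_pt z v b) (ray_pt z v e) z"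
proof -
  have be: "b < e" using ab mid by auto
  define c y d where "c = ray_pt z v a" and "y = ray_pt z v b" and "d = ray_pt z v e"
  define s t \<zeta> where "s = 1 / a - 1 / b" and "t = 1 / b - 1 / e" and "\<zeta> = 1 / b"
  have st: "0 < s" "0 < t" using ab be pos by (auto simp: s_def t_def field_simps)
  have z0: "0 < \<zeta>" using pos ab by (simp add: \<zeta>_def)
  have "s * (\<zeta> - t) = t * (\<zeta> + s)" using mid pos ab be by (simp add: s_def t_def \<zeta>_def field_simps)
  then have zeta: "(s - t) * \<zeta> = 2 * s * t" by (simp add: algebra_simps)
  then have "0 < (s - t) * \<zeta>" using st by simp
  \<comment> \<open>This makes \<open>2 * s * t / (s - t)\<close> a legitimate value of
    \<open>\<zeta>\<close> and places \<open>Q\<close> between \<open>S\<close> and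
    \<open>z\<close>.\<close>
  then have "t < s" using z0 by (simp add: zero_less_mult_iff)
  have c: "c = y + (- s) *\<^sub>R v" and d: "d = y + t *\<^sub>R v" and z: "z = y + \<zeta> *\<^sub>R v"
    by (auto simp: c_def y_def d_def ray_pt_def s_def t_def \<zeta>_def algebra_simps)
  obtain w0 where w0: "w0 \<noteq> 0" "orthogonal v w0" using orthogonal_to_vector_exists[OF dim] by blast
  obtain \<epsilon> where eps: "0 < \<epsilon>" "cball y \<epsilon> \<subseteq> K"
    using inK(2) mem_interior_cball unfolding y_def by blast
  define w where "w = (\<epsilon> / norm w0) *\<^sub>R w0"
  define P where "P = y + w"
  have w: "w \<noteq> 0" "v \<bullet> w = 0" using w0 eps by (auto simp: w_def orthogonal_def)
  have PK: "P \<in> K" using eps w0 by (auto simp: P_def w_def dist_norm intro!: subsetD[OF eps(2)])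
  define pt where "pt x r = y + x *\<^sub>R v + r *\<^sub>R w" for x r
  have betw_pt: "betw (pt x1 r1) (pt x r) (pt x2 r2)"
    if "0 \<le> k" "k \<le> 1" "x = x1 + k * (x2 - x1)" "r = r1 + k * (r2 - r1)" for k x r x1 r1 x2 r2
    by (rule betwI[OF that(1,2)]) (simp add: that pt_def algebra_simps)
  \<comment> \<open>\<open>R\<close> is the midpoint of \<open>yP\<close>; \<open>Q\<close> and
    \<open>S\<close> are the intersections of \<open>cR\<close> with \<open>dP\<close> and of
    \<open>dR\<close> with \<open>cP\<close>.\<close>
  define R Q S where "R = pt 0 (1 / 2)" and "Q = pt (s * t / (2 * s + t)) ((s + t) / (2 * s + t))"
    and "S = pt (- (s * t / (2 * t + s))) ((s + t) / (2 * t + s))"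
  have pts: "c = pt (- s) 0" "y = pt 0 0" "d = pt t 0" "z = pt \<zeta> 0" "P = pt 0 1"
    by (simp_all add: pt_def c d z P_def)
  have yRP: "betw y R P"
    unfolding pts R_def by (rule betw_pt[of "1 / 2"]) auto
  have dQP: "betw d Q P"
    unfolding pts Q_def using st
    by (intro betw_pt[of "(s + t) / (2 * s + t)"]) (auto simp: field_simps)
  have cSP: "betw c S P"
    unfolding pts S_def using st
    by (intro betw_pt[of "(s + t) / (2 * t + s)"]) (auto simp: field_simps)
  have cRQ: "betw c R Q"
    unfolding pts R_def Q_def using st
    by (intro betw_pt[of "(2 * s + t) / (2 * (s + t))"]) (auto simp: divide_simps, algebra+)
  have dRS: "betw d R S"
    unfolding pts R_def S_def using st
    by (intro betw_pt[of "(2 * t + s) / (2 * (s + t))"]) (auto simp: divide_simps, algebra+)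
  have SQz: "betw S Q z"
  proof -
    have zeta': "\<zeta> = 2 * s * t / (s - t)" using zeta \<open>t < s\<close> by (simp add: field_simps)
    \<comment> \<open>The coefficient comes from the heights: that of \<open>Q\<close> is
      \<open>(2 * t + s) / (2 * s + t)\<close> times that of \<open>S\<close>, and \<open>z\<close>
      has height 0.\<close>
    show ?thesis
      unfolding pts S_def Q_def zeta' using st \<open>t < s\<close>
      by (intro betw_pt[of "(s - t) / (2 * s + t)"]) (auto simp: divide_simps, algebra+)
  qed
  have off: "P \<noteq> y + x *\<^sub>R v" for x
    using w by (auto simp: P_def)
  have line: "\<exists>x. p = y + x *\<^sub>R v" if b: "betw c p d" for p
  proof -
    obtain k where "p = c + k *\<^sub>R (d - c)" using b by (rule betwE)
    then have "p = y + (- s + k * (t + s)) *\<^sub>R v" by (simp add: c d algebra_simps)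
    then show ?thesis by blast
  qed
  \<comment> \<open>The inner product with \<open>w\<close> measures height over the line; comparing
    heights below forces \<open>k\<close> to an end value and thus \<open>c = d\<close>.\<close>
  have nz: "w \<bullet> w \<noteq> 0" "w \<bullet> v = 0" using w by (auto simp: inner_commute)
  have "c \<noteq> d" using v ab be by (simp add: c_def d_def)
  have nPcd: "\<not> betw P c d"
  proof
    assume "betw P c d"
    then obtain k where k: "c = P + k *\<^sub>R (d - P)" by (rule betwE)
    then have "w \<bullet> (c - y) = w \<bullet> (P + k *\<^sub>R (d - P) - y)" by simp
    then have "k = 1" using nz by (simp add: c d P_def inner_simps algebra_simps)
    then show False using k \<open>c \<noteq> d\<close> by simp
  qed
  have ncdP: "\<not> betw c d P"
  proof
    assume "betw c d P"
    then obtain k where k: "d = c + k *\<^sub>R (P - c)" by (rule betwE)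
    then have "w \<bullet> (d - y) = w \<bullet> (c + k *\<^sub>R (P - c) - y)" by simp
    then have "k = 0" using nz by (simp add: c d P_def inner_simps algebra_simps)
    then show False using k \<open>c \<noteq> d\<close> by simp
  qed
  have cdK: "c \<in> K" "d \<in> K" "y \<in> K"
    using inK interior_subset by (auto simp: c_def d_def y_def)
  have in_K: "R \<in> K" "Q \<in> K" "S \<in> K"
    using convex_betw[OF K] cdK PK yRP dQP cSP by blast+
  have "R \<noteq> y" "R \<noteq> P"
    using w scaleR_cancel_right[of "1 / 2" w 1] by (auto simp: R_def P_def pt_def)
  moreover have "\<not> betw c P d" using line off by blast
  moreover have "betw c y d" "betw y d z" "c \<noteq> y" "y \<noteq> d" "d \<noteq> z"
    using pos ab be v by (auto simp: c_def y_def d_def betw_ray_pt_iff betw_ray_pt_end_iff)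
  ultimately show ?thesis
    unfolding harmonic_def c_def[symmetric] d_def[symmetric] y_def[symmetric]
    using PK in_K nPcd ncdP yRP dQP cSP cRQ dRS SQz by blast
qed

section \<open>Arithmetic progressions\<close>

text \<open>Two consecutive terms are carried along, because a harmonic step computes the next term
  from the last two.\<close>

primrec chain :: "'a::real_vector set \<Rightarrow> 'a \<Rightarrow> 'a \<Rightarrow> 'a \<Rightarrow> nat \<Rightarrow> 'a \<Rightarrow> 'a \<Rightarrow> bool" where
  "chain K p t z 0 x y \<longleftrightarrow> x = p \<and> y = t"
| "chain K p t z (Suc n) x y \<longleftrightarrow> (\<exists>r\<in>K. chain K p t z n r x \<and> harmonic K r x y z)"

text \<open>Larger parameters lie closer to \<open>z\<close>, so an increasing progression started
  in the interior never leaves it.\<close>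

lemma ray_pt_interior:
  fixes z v :: "'a::real_normed_vector"
  assumes "convex K" "z \<in> interior K" "v \<noteq> 0" "0 < a" "ray_pt z v a \<in> interior K" "a \<le> b"
  shows "ray_pt z v b \<in> interior K"
  using assms convex_betw[OF convex_interior[OF assms(1)], of "ray_pt z v a" z]
  by (simp add: betw_ray_pt_end_iff)

text \<open>The midpoint relation makes the next term unique. It is also reached, since the middle
  point of each harmonic step is interior.\<close>

lemma chain_iff:
  fixes z v :: "'a::euclidean_space"
  assumes dim: "2 \<le> DIM('a)" and K: "convex K" "z \<in> interior K" and v: "v \<noteq> 0"
    and pos: "0 < g" "0 < h" and p: "ray_pt z v g \<in> interior K"
  shows "chain K (ray_pt z v g) (ray_pt z v (g + h)) z n x y \<longleftrightarrow>
    x = ray_pt z v (g + real n * h) \<and> y = ray_pt z v (g + real (Suc n) * h)"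
proof (induction n arbitrary: x y)
  case 0
  then show ?case by simp
next
  case (Suc n)
  define q where "q k = ray_pt z v (g + real k * h)" for k
  have gpos: "0 < g + real k * h" for k
    using pos by (simp add: add_pos_nonneg)
  have int: "q k \<in> interior K" for k
    unfolding q_def using pos by (intro ray_pt_interior[OF K v pos(1) p]) auto
  have inK: "q k \<in> K" for k using int interior_subset by blast
  have "harmonic K (q n) (q (Suc n)) y z \<longleftrightarrow> y = q (Suc (Suc n))"
  proof
    assume h: "harmonic K (q n) (q (Suc n)) y z"
    \<comment> \<open>The betweenness part of \<open>harmonic\<close> puts the unknown
      \<open>y\<close> on the ray, so that it has a parameter at all.\<close>
    then have "betw (q (Suc n)) y z" "y \<noteq> z" by (auto simp: harmonic_def)
    then obtain e where e: "g + real (Suc n) * h \<le> e" "y = ray_pt z v e"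
      unfolding q_def by (rule betw_ray_pt_endE[OF v gpos])
    then have "0 < e" using gpos[of "Suc n"] by linarith
    then have "2 * (g + real (Suc n) * h) = (g + real n * h) + e"
      using harmonic_imp_midpoint(2)[OF v gpos gpos] h unfolding q_def e(2) by blast
    then have "e = g + real (Suc (Suc n)) * h" by (simp add: algebra_simps)
    then show "y = q (Suc (Suc n))" by (simp add: e(2) q_def)
  next
    assume y: "y = q (Suc (Suc n))"
    show "harmonic K (q n) (q (Suc n)) y z"
      unfolding y using inK[of n] int[of "Suc n"] inK[of "Suc (Suc n)"] unfolding q_def
      by (intro midpoint_imp_harmonic[OF dim K(1) v gpos]) (use pos in \<open>auto simp: algebra_simps\<close>)
  qed
  moreover have "chain K (ray_pt z v g) (ray_pt z v (g + h)) z (Suc n) x y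
      \<longleftrightarrow> x = q (Suc n) \<and> harmonic K (q n) (q (Suc n)) y z"
    using inK by (auto simp: Suc.IH q_def simp del: of_nat_Suc)
  ultimately show ?case by (simp add: q_def)
qed

text \<open>Each \<open>y\<close> is the successor delivered by \<open>chain\<close> along with the
  wanted term, and is projected away.\<close>

definition net :: "'a::real_vector set \<Rightarrow> nat \<Rightarrow> nat \<Rightarrow> nat \<Rightarrow> 'a \<Rightarrow> 'a \<Rightarrow> 'a \<Rightarrow> 'a \<Rightarrow> bool" where
  "net K i j k z b c d \<longleftrightarrow> (\<exists>p\<in>K. \<exists>t\<in>K. betw p t z \<and> p \<noteq> t \<and> t \<noteq> z \<and>
     (\<exists>y\<in>K. chain K p t z i b y) \<and> (\<exists>y\<in>K. chain K p t z j c y) \<and> (\<exists>y\<in>K. chain K p t z k d y))"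

lemma net_iff:
  fixes z v :: "'a::euclidean_space"
  assumes dim: "2 \<le> DIM('a)" and K: "convex K" "z \<in> interior K" and v: "v \<noteq> 0"
    and pos: "0 < \<beta>" "0 < \<gamma>" "0 < \<delta>"
    and int: "ray_pt z v \<beta> \<in> interior K" "ray_pt z v \<gamma> \<in> interior K" "ray_pt z v \<delta> \<in> interior K"
    and zero: "0 \<in> {i, j, k}"
  shows "net K i j k z (ray_pt z v \<beta>) (ray_pt z v \<gamma>) (ray_pt z v \<delta>) \<longleftrightarrow>
    (\<exists>g h. 0 < g \<and> 0 < h \<and> \<beta> = g + real i * h \<and> \<gamma> = g + real j * h \<and> \<delta> = g + real k * h)"
    (is "?N \<longleftrightarrow> ?P")
proof -
  have ch: "(\<exists>y\<in>K. chain K (ray_pt z v g) (ray_pt z v (g + h)) z n (ray_pt z v x) y) \<longleftrightarrow> x = g + real n * h"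
    if "0 < g" "0 < h" "ray_pt z v g \<in> interior K" for g h n x
  proof -
    have "ray_pt z v (g + real (Suc n) * h) \<in> K"
      using ray_pt_interior[OF K v that(1,3), of "g + real (Suc n) * h"] that interior_subset by auto
    then show ?thesis using chain_iff[OF dim K v that] v by auto
  qed
  show ?thesis
  proof
    assume ?N
    then obtain p t where pt: "betw p t z" "p \<noteq> t" "t \<noteq> z" and
      chs: "\<exists>y\<in>K. chain K p t z i (ray_pt z v \<beta>) y" "\<exists>y\<in>K. chain K p t z j (ray_pt z v \<gamma>) y"
        "\<exists>y\<in>K. chain K p t z k (ray_pt z v \<delta>) y"
      unfolding net_def by blast
    \<comment> \<open>The point with index 0 is the start \<open>p\<close>, which is therefore on
      the ray and interior.\<close>
    from zero chs have "p \<in> {ray_pt z v \<beta>, ray_pt z v \<gamma>, ray_pt z v \<delta>}" by auto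
    then obtain g where g: "0 < g" "p = ray_pt z v g" "ray_pt z v g \<in> interior K"
      using pos int v by auto
    obtain g' where g': "g \<le> g'" "t = ray_pt z v g'"
      using pt(1,3) unfolding g(2) by (rule betw_ray_pt_endE[OF v g(1)])
    define h where "h = g' - g"
    have h: "0 < h" "g' = g + h" using pt(2) g' g(2) by (auto simp: h_def less_le)
    have "\<beta> = g + real i * h" "\<gamma> = g + real j * h" "\<delta> = g + real k * h"
      using chs unfolding g(2) g'(2) h(2) ch[OF g(1) h(1) g(3)] .
    then show ?P using g(1) h(1) by blast
  next
    assume ?P
    then obtain g h where gh: "0 < g" "0 < h"
      and eq: "\<beta> = g + real i * h" "\<gamma> = g + real j * h" "\<delta> = g + real k * h" by blast
    have "g \<in> {\<beta>, \<gamma>, \<delta>}" using zero eq by auto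
    then have g: "ray_pt z v g \<in> interior K" using int by blast
    then have t: "ray_pt z v (g + h) \<in> interior K" using gh by (intro ray_pt_interior[OF K v gh(1) g]) auto
    have "ray_pt z v g \<in> K" "ray_pt z v (g + h) \<in> K" using g t interior_subset by blast+
    moreover have "betw (ray_pt z v g) (ray_pt z v (g + h)) z" "ray_pt z v g \<noteq> ray_pt z v (g + h)"
      "ray_pt z v (g + h) \<noteq> z"
      using gh v by (auto simp: betw_ray_pt_end_iff)
    ultimately show ?N unfolding net_def using eq[folded ch[OF gh g]]
      by - (rule bexI[of _ "ray_pt z v g"], rule bexI[of _ "ray_pt z v (g + h)"], intro conjI)
  qed
qed

section \<open>The cross-ratio with an extreme first point\<close>

text \<open>The progression must start at one of the three points to stay inside \<open>K\<close>; the two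
  disjuncts are the two possible orders of \<open>b\<close> and \<open>c\<close>.\<close>

definition ratio_eq :: "'a::real_vector set \<Rightarrow> int \<Rightarrow> int \<Rightarrow> 'a \<Rightarrow> 'a \<Rightarrow> 'a \<Rightarrow> 'a \<Rightarrow> bool" where
  "ratio_eq K m n a b c d \<longleftrightarrow>
     net K (nat (max 0 (- m))) (nat (max 0 (- m) + n)) (nat (max 0 (- m) + m)) a b c d \<or>
     net K (nat (max n m)) (nat (max n m - n)) (nat (max n m - m)) a b c d"

text \<open>The point with cross-ratio exactly \<open>m / n\<close> may lie outside \<open>K\<close>, but not if it lies between
  \<open>d\<close> and \<open>a\<close>.\<close>

definition ratio_gt :: "'a::real_vector set \<Rightarrow> int \<Rightarrow> int \<Rightarrow> 'a \<Rightarrow> 'a \<Rightarrow> 'a \<Rightarrow> 'a \<Rightarrow> bool" where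
  "ratio_gt K m n a b c d \<longleftrightarrow>
     betw b c a \<and> \<not> (\<exists>x\<in>K. betw d x a \<and> x \<noteq> a \<and> ratio_eq K m n a b c x) \<or>
     betw c b a \<and> (\<exists>x\<in>K. betw d x a \<and> x \<noteq> a \<and> x \<noteq> d \<and> ratio_eq K m n a b c x)"

lemma ratio_eq_iff:
  fixes z v :: "'a::euclidean_space"
  assumes dim: "2 \<le> DIM('a)" and K: "convex K" "z \<in> interior K" and v: "v \<noteq> 0"
    and pos: "0 < \<beta>" "0 < \<gamma>" "0 < \<delta>"
    and int: "ray_pt z v \<beta> \<in> interior K" "ray_pt z v \<gamma> \<in> interior K" "ray_pt z v \<delta> \<in> interior K"
    and n: "0 < n" and ne: "\<beta> \<noteq> \<gamma>"
  shows "ratio_eq K m n z (ray_pt z v \<beta>) (ray_pt z v \<gamma>) (ray_pt z v \<delta>) \<longleftrightarrow>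
    (\<delta> - \<beta>) / (\<gamma> - \<beta>) = of_int m / of_int n"
proof -
  note ni = net_iff[OF dim K v pos int]
  \<comment> \<open>Relative to \<open>\<beta>\<close> the three points have indices 0,
    \<open>n\<close>, \<open>m\<close>. The least of these is \<open>- N1\<close> and the greatest
    is \<open>N2\<close>, so shifting, or reflecting and shifting, gives natural numbers including
    0.\<close>
  define N1 N2 where "N1 = max 0 (- m)" and "N2 = max n m"
  have N1: "0 \<le> N1" "0 \<le> N1 + n" "0 \<le> N1 + m" "N1 = 0 \<or> N1 + m = 0"
    and N2: "0 \<le> N2" "0 \<le> N2 - n" "0 \<le> N2 - m" "N2 - n = 0 \<or> N2 - m = 0"
    using n by (auto simp: N1_def N2_def)
  have z1: "0 \<in> {nat N1, nat (N1 + n), nat (N1 + m)}" using N1(4) by auto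
  have z2: "0 \<in> {nat N2, nat (N2 - n), nat (N2 - m)}" using N2(4) by auto
  have nats: "real (nat N1) = of_int N1" "real (nat (N1 + n)) = of_int N1 + of_int n"
    "real (nat (N1 + m)) = of_int N1 + of_int m" "real (nat N2) = of_int N2"
    "real (nat (N2 - n)) = of_int N2 - of_int n" "real (nat (N2 - m)) = of_int N2 - of_int m"
    using N1 N2 by (simp_all add: of_nat_nat)
  have eq: "(\<delta> - \<beta>) / (\<gamma> - \<beta>) = of_int m / of_int n \<longleftrightarrow> of_int n * (\<delta> - \<beta>) = of_int m * (\<gamma> - \<beta>)"
    using ne n by (auto simp: frac_eq_eq algebra_simps)
  show ?thesis
    unfolding ratio_eq_def N1_def[symmetric] N2_def[symmetric] ni[OF z1] ni[OF z2] eq nats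
  proof
    assume "(\<exists>g h. 0 < g \<and> 0 < h \<and> \<beta> = g + of_int N1 * h \<and> \<gamma> = g + (of_int N1 + of_int n) * h
        \<and> \<delta> = g + (of_int N1 + of_int m) * h) \<or>
      (\<exists>g h. 0 < g \<and> 0 < h \<and> \<beta> = g + of_int N2 * h \<and> \<gamma> = g + (of_int N2 - of_int n) * h
        \<and> \<delta> = g + (of_int N2 - of_int m) * h)"
    then obtain h where "\<delta> - \<beta> = of_int m * h" "\<gamma> - \<beta> = of_int n * h"
    proof (elim disjE exE conjE)
      fix g h
      assume "\<beta> = g + of_int N1 * h" "\<gamma> = g + (of_int N1 + of_int n) * h"
        "\<delta> = g + (of_int N1 + of_int m) * h"
      then show thesis by (intro that[of h]) (simp_all add: algebra_simps)
    next
      fix g h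
      assume "\<beta> = g + of_int N2 * h" "\<gamma> = g + (of_int N2 - of_int n) * h"
        "\<delta> = g + (of_int N2 - of_int m) * h"
      then show thesis by (intro that[of "- h"]) (simp_all add: algebra_simps)
    qed
    then show "of_int n * (\<delta> - \<beta>) = of_int m * (\<gamma> - \<beta>)" by simp
  next
    assume e: "of_int n * (\<delta> - \<beta>) = of_int m * (\<gamma> - \<beta>)"
    \<comment> \<open>The signed step of the progression; its sign selects the disjunct.\<close>
    define h where "h = (\<gamma> - \<beta>) / of_int n"
    have h: "\<gamma> = \<beta> + of_int n * h" "\<delta> = \<beta> + of_int m * h"
      using n e by (auto simp: h_def field_simps)
    show "(\<exists>g h. 0 < g \<and> 0 < h \<and> \<beta> = g + of_int N1 * h \<and> \<gamma> = g + (of_int N1 + of_int n) * h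
        \<and> \<delta> = g + (of_int N1 + of_int m) * h) \<or>
      (\<exists>g h. 0 < g \<and> 0 < h \<and> \<beta> = g + of_int N2 * h \<and> \<gamma> = g + (of_int N2 - of_int n) * h
        \<and> \<delta> = g + (of_int N2 - of_int m) * h)"
    proof (cases "\<beta> < \<gamma>")
      case True
      then have "0 < h" using n by (simp add: h_def)
      \<comment> \<open>The start of the progression is \<open>\<beta>\<close> or
        \<open>\<delta>\<close>, hence positive.\<close>
      moreover have "0 < \<beta> - of_int N1 * h"
        using pos h by (auto simp: N1_def max_def)
      ultimately show ?thesis
        using h by (intro disjI1 exI[of _ "\<beta> - of_int N1 * h"] exI[of _ h]) (auto simp: algebra_simps)
    next
      case False
      then have "0 < - h" using n ne by (simp add: h_def divide_less_0_iff)
      moreover have "0 < \<beta> - of_int N2 * (- h)"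
        using pos h by (auto simp: N2_def max_def)
      ultimately show ?thesis
        using h by (intro disjI2 exI[of _ "\<beta> - of_int N2 * (- h)"] exI[of _ "- h"])
          (auto simp: algebra_simps)
    qed
  qed
qed

text \<open>The quotient is monotone in \<open>\<delta>\<close>, with direction given by the sign of
  \<open>\<gamma> - \<beta>\<close>. Comparing it with \<open>m / n\<close> thus amounts to
  comparing \<open>\<delta>\<close> with the parameter \<open>\<delta>'\<close> of exact
  ratio.\<close>

lemma ratio_gt_iff:
  fixes z v :: "'a::euclidean_space"
  assumes dim: "2 \<le> DIM('a)" and K: "convex K" "z \<in> interior K" and v: "v \<noteq> 0"
    and pos: "0 < \<beta>" "0 < \<gamma>" "0 < \<delta>"
    and int: "ray_pt z v \<beta> \<in> interior K" "ray_pt z v \<gamma> \<in> interior K" "ray_pt z v \<delta> \<in> interior K"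
    and n: "0 < n" and ne: "\<beta> \<noteq> \<gamma>"
  shows "ratio_gt K m n z (ray_pt z v \<beta>) (ray_pt z v \<gamma>) (ray_pt z v \<delta>) \<longleftrightarrow>
    (\<delta> - \<beta>) / (\<gamma> - \<beta>) > of_int m / of_int n"
proof -
  define q :: real where "q = of_int m / of_int n"
  define \<delta>' where "\<delta>' = \<beta> + q * (\<gamma> - \<beta>)"
  \<comment> \<open>The extra condition \<open>Q\<close> lets one equivalence serve both disjuncts
    of \<open>ratio_gt\<close>: it is trivial in the first and \<open>x \<noteq> d\<close> in the
    second.\<close>
  have ex: "(\<exists>x\<in>K. betw (ray_pt z v \<delta>) x z \<and> x \<noteq> z \<and> Q x \<and> ratio_eq K m n z (ray_pt z v \<beta>) (ray_pt z v \<gamma>) x)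
      \<longleftrightarrow> \<delta> \<le> \<delta>' \<and> Q (ray_pt z v \<delta>')" for Q
  proof -
    have *: "ray_pt z v x \<in> interior K
        \<and> (ratio_eq K m n z (ray_pt z v \<beta>) (ray_pt z v \<gamma>) (ray_pt z v x) \<longleftrightarrow> x = \<delta>')"
      if "\<delta> \<le> x" for x
    proof -
      have x: "0 < x" "ray_pt z v x \<in> interior K"
        using that pos ray_pt_interior[OF K v pos(3) int(3)] by auto
      then show ?thesis
        using ratio_eq_iff[OF dim K v pos(1,2) _ int(1,2) _ n ne, of x m] ne
        by (auto simp: \<delta>'_def q_def[symmetric] field_simps)
    qed
    show ?thesis
    proof
      assume "\<exists>x\<in>K. betw (ray_pt z v \<delta>) x z \<and> x \<noteq> z \<and> Q x
        \<and> ratio_eq K m n z (ray_pt z v \<beta>) (ray_pt z v \<gamma>) x"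
      then show "\<delta> \<le> \<delta>' \<and> Q (ray_pt z v \<delta>')"
        using * betw_ray_pt_endE[OF v pos(3)] by metis
    next
      assume "\<delta> \<le> \<delta>' \<and> Q (ray_pt z v \<delta>')"
      then show "\<exists>x\<in>K. betw (ray_pt z v \<delta>) x z \<and> x \<noteq> z \<and> Q x
        \<and> ratio_eq K m n z (ray_pt z v \<beta>) (ray_pt z v \<gamma>) x"
        using *[of \<delta>'] pos v interior_subset
        by (intro bexI[of _ "ray_pt z v \<delta>'"]) (auto simp: betw_ray_pt_end_iff)
    qed
  qed
  have "ratio_gt K m n z (ray_pt z v \<beta>) (ray_pt z v \<gamma>) (ray_pt z v \<delta>) \<longleftrightarrow>
      \<beta> \<le> \<gamma> \<and> \<not> \<delta> \<le> \<delta>' \<or> \<gamma> \<le> \<beta> \<and> \<delta> \<le> \<delta>' \<and> \<delta>' \<noteq> \<delta>"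
    unfolding ratio_gt_def using ex[of "\<lambda>_. True"] ex[of "\<lambda>x. x \<noteq> ray_pt z v \<delta>"] pos v
    by (simp add: betw_ray_pt_end_iff)
  also have "\<dots> \<longleftrightarrow> q < (\<delta> - \<beta>) / (\<gamma> - \<beta>)"
  proof (cases "\<beta> < \<gamma>")
    case True
    then show ?thesis by (auto simp: \<delta>'_def pos_less_divide_eq algebra_simps)
  next
    case False
    with ne have "\<gamma> - \<beta> < 0" by auto
    then show ?thesis by (auto simp: \<delta>'_def neg_less_divide_eq algebra_simps)
  qed
  finally show ?thesis by (simp add: q_def)
qed

section \<open>Moving an endpoint to the first place\<close>

definition extreme :: "'a::real_vector \<Rightarrow> 'a \<Rightarrow> 'a \<Rightarrow> 'a \<Rightarrow> bool" where
  "extreme a b c d \<longleftrightarrow> \<not> betw b a c \<and> \<not> betw b a d \<and> \<not> betw c a d"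

lemma collinear4E:
  assumes "collinear {a, b, c, d}" "distinct [a, b, c, d]"
  obtains v \<beta> \<gamma> \<delta> where "v \<noteq> 0" "b = a + \<beta> *\<^sub>R v" "c = a + \<gamma> *\<^sub>R v" "d = a + \<delta> *\<^sub>R v"
    "distinct [0, \<beta>, \<gamma>, \<delta>]"
proof -
  obtain v where v: "\<And>x y. x \<in> {a, b, c, d} \<Longrightarrow> y \<in> {a, b, c, d} \<Longrightarrow> \<exists>t. x - y = t *\<^sub>R v"
    using assms(1) unfolding collinear_def by blast
  obtain \<beta> \<gamma> \<delta> where "b - a = \<beta> *\<^sub>R v" "c - a = \<gamma> *\<^sub>R v" "d - a = \<delta> *\<^sub>R v"
    using v[of b a] v[of c a] v[of d a] by blast
  then have "b = a + \<beta> *\<^sub>R v" "c = a + \<gamma> *\<^sub>R v" "d = a + \<delta> *\<^sub>R v" by (simp_all add: diff_eq_eq add.commute)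
  with assms(2) show thesis by (intro that[of v \<beta> \<gamma> \<delta>]) auto
qed

text \<open>The other points lie on one side of \<open>a\<close>, so a sign \<open>\<sigma>\<close>
  of the direction makes all ray parameters positive. Inverting the coordinate sends
  \<open>a\<close> to infinity and reduces the cross-ratio to a simple ratio.\<close>

lemma extreme_rayE:
  assumes "collinear {a, b, c, d}" "distinct [a, b, c, d]" "extreme a b c d"
  obtains v \<beta> \<gamma> \<delta> where "v \<noteq> 0" "0 < \<beta>" "0 < \<gamma>" "0 < \<delta>" "\<beta> \<noteq> \<gamma>"
    "b = ray_pt a v \<beta>" "c = ray_pt a v \<gamma>" "d = ray_pt a v \<delta>"
    "cross_ratio a b c d = (\<delta> - \<beta>) / (\<gamma> - \<beta>)"
proof -
  obtain v \<beta> \<gamma> \<delta> where v: "v \<noteq> 0" and eq: "b = a + \<beta> *\<^sub>R v" "c = a + \<gamma> *\<^sub>R v" "d = a + \<delta> *\<^sub>R v"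
    and dist: "distinct [0, \<beta>, \<gamma>, \<delta>]" using collinear4E[OF assms(1,2)] .
  have "\<not> (\<beta> \<le> 0 \<and> 0 \<le> \<gamma> \<or> \<gamma> \<le> 0 \<and> 0 \<le> \<beta>)" "\<not> (\<beta> \<le> 0 \<and> 0 \<le> \<delta> \<or> \<delta> \<le> 0 \<and> 0 \<le> \<beta>)"
    using assms(3) betw_line_iff[OF v, of a \<beta> 0 \<gamma>] betw_line_iff[OF v, of a \<beta> 0 \<delta>]
    by (simp_all add: extreme_def eq)
  then have "0 < \<beta> \<and> 0 < \<gamma> \<and> 0 < \<delta> \<or> \<beta> < 0 \<and> \<gamma> < 0 \<and> \<delta> < 0" using dist by auto
  then obtain \<sigma> :: real where sig: "\<sigma> \<noteq> 0" "0 < - \<sigma> / \<beta>" "0 < - \<sigma> / \<gamma>" "0 < - \<sigma> / \<delta>"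
  proof (elim disjE)
    assume "0 < \<beta> \<and> 0 < \<gamma> \<and> 0 < \<delta>"
    then show thesis by (intro that[of "- 1"]) auto
  next
    assume "\<beta> < 0 \<and> \<gamma> < 0 \<and> \<delta> < 0"
    then show thesis by (intro that[of 1]) auto
  qed
  have ray: "a + x *\<^sub>R v = ray_pt a (\<sigma> *\<^sub>R v) (- \<sigma> / x)" for x
    using sig(1) by (simp add: ray_pt_def)
  have "cross_ratio a b c d = ((\<gamma> - 0) * (\<delta> - \<beta>)) / ((\<gamma> - \<beta>) * (\<delta> - 0))"
    by (rule cross_ratio_eqI[OF assms(2) v _ eq]) simp
  also have "\<dots> = (- \<sigma> / \<delta> - - \<sigma> / \<beta>) / (- \<sigma> / \<gamma> - - \<sigma> / \<beta>)"
  proof -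
    have nz: "\<beta> \<noteq> 0" "\<gamma> \<noteq> 0" "\<delta> \<noteq> 0" using dist by auto
    have "- \<sigma> / \<delta> - - \<sigma> / \<beta> = (\<delta> - \<beta>) * (\<sigma> / (\<beta> * \<delta>))"
      "- \<sigma> / \<gamma> - - \<sigma> / \<beta> = (\<gamma> - \<beta>) * (\<sigma> / (\<beta> * \<gamma>))"
      using nz by (simp_all add: field_simps)
    then show ?thesis using nz sig(1) by (simp only:) (simp add: ac_simps)
  qed
  finally have cr: "cross_ratio a b c d = (- \<sigma> / \<delta> - - \<sigma> / \<beta>) / (- \<sigma> / \<gamma> - - \<sigma> / \<beta>)" .
  have ne: "- \<sigma> / \<beta> \<noteq> - \<sigma> / \<gamma>" using sig(1) dist by auto
  show thesis
    by (rule that[OF _ sig(2-4) ne _ _ _ cr]) (use v sig(1) in \<open>simp_all only: eq ray, simp\<close>)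
qed

text \<open>The point with the largest coordinate is an endpoint, and each point comes first in one
  of the four arrangements.\<close>

lemma ex_extreme:
  assumes "collinear {a, b, c, d}" "distinct [a, b, c, d]"
  shows "extreme a b c d \<or> extreme b a d c \<or> extreme c d a b \<or> extreme d c b a"
proof -
  obtain v \<beta> \<gamma> \<delta> where v: "v \<noteq> 0" and eq: "b = a + \<beta> *\<^sub>R v" "c = a + \<gamma> *\<^sub>R v" "d = a + \<delta> *\<^sub>R v"
    and dist: "distinct [0, \<beta>, \<gamma>, \<delta>]" using collinear4E[OF assms] .
  define P where "P x = a + x *\<^sub>R v" for x
  have pts: "a = P 0" "b = P \<beta>" "c = P \<gamma>" "d = P \<delta>" by (simp_all add: P_def eq)
  have ext: "extreme (P x) (P y) (P w) (P u)" if "y < x" "w < x" "u < x" for x y w u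
    using that unfolding extreme_def P_def betw_line_iff[OF v] by auto
  define M where "M = Max {0, \<beta>, \<gamma>, \<delta>}"
  have M: "0 \<le> M" "\<beta> \<le> M" "\<gamma> \<le> M" "\<delta> \<le> M" by (auto simp: M_def)
  have "M \<in> {0, \<beta>, \<gamma>, \<delta>}" unfolding M_def by (rule Max_in) auto
  then consider "M = 0" | "M = \<beta>" | "M = \<gamma>" | "M = \<delta>" by blast
  then show ?thesis
  proof cases
    case 1
    with M dist have "extreme a b c d" unfolding pts by (intro ext) auto
    then show ?thesis ..
  next
    case 2
    with M dist have "extreme b a d c" unfolding pts by (intro ext) auto
    then show ?thesis by blast
  next
    case 3
    with M dist have "extreme c d a b" unfolding pts by (intro ext) auto
    then show ?thesis by blast
  next
    case 4
    with M dist have "extreme d c b a" unfolding pts by (intro ext) auto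
    then show ?thesis by blast
  qed
qed

text \<open>Each double transposition permutes the factors within numerator and denominator, with an
  even number of sign changes in each.\<close>

lemma cross_ratio_perm:
  assumes "collinear {a, b, c, d}" "distinct [a, b, c, d]"
  shows "cross_ratio b a d c = cross_ratio a b c d" "cross_ratio c d a b = cross_ratio a b c d"
    "cross_ratio d c b a = cross_ratio a b c d"
proof -
  obtain v \<beta> \<gamma> \<delta> where v: "v \<noteq> 0" and eq: "b = a + \<beta> *\<^sub>R v" "c = a + \<gamma> *\<^sub>R v" "d = a + \<delta> *\<^sub>R v"
    and dist: "distinct [0, \<beta>, \<gamma>, \<delta>]" using collinear4E[OF assms] .
  have a: "a = a + 0 *\<^sub>R v" by simp
  have d: "distinct [b, a, d, c]" "distinct [c, d, a, b]" "distinct [d, c, b, a]"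
    using assms(2) by auto
  note cr = cross_ratio_eqI[OF assms(2) v a eq]
  show "cross_ratio b a d c = cross_ratio a b c d"
    unfolding cr cross_ratio_eqI[OF d(1) v eq(1) a eq(3,2)] by (simp add: algebra_simps)
  show "cross_ratio c d a b = cross_ratio a b c d"
    unfolding cr cross_ratio_eqI[OF d(2) v eq(2,3) a eq(1)] by (simp add: algebra_simps)
  show "cross_ratio d c b a = cross_ratio a b c d"
    unfolding cr cross_ratio_eqI[OF d(3) v eq(3,2,1) a] by (simp add: algebra_simps)
qed

definition symm :: "('a::real_vector \<Rightarrow> 'a \<Rightarrow> 'a \<Rightarrow> 'a \<Rightarrow> bool) \<Rightarrow> 'a \<Rightarrow> 'a \<Rightarrow> 'a \<Rightarrow> 'a \<Rightarrow> bool" where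
  "symm R a b c d \<longleftrightarrow> extreme a b c d \<and> R a b c d \<or> extreme b a d c \<and> R b a d c \<or>
     extreme c d a b \<and> R c d a b \<or> extreme d c b a \<and> R d c b a"

text \<open>Different endpoints can satisfy different disjuncts, but all of these evaluate the same
  cross-ratio. The predicate \<open>Q\<close> covers equality and inequality at once.\<close>

lemma symm_iff:
  fixes a b c d :: "'a::real_vector"
  assumes col: "collinear {a, b, c, d}" and dist: "distinct [a, b, c, d]"
    and in_U: "{a, b, c, d} \<subseteq> U"
    and R: "\<And>a b c d. {a, b, c, d} \<subseteq> U \<Longrightarrow> collinear {a, b, c, d} \<Longrightarrow> distinct [a, b, c, d]
      \<Longrightarrow> extreme a b c d \<Longrightarrow> R a b c d \<longleftrightarrow> Q (cross_ratio a b c d)"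
  shows "symm R a b c d \<longleftrightarrow> Q (cross_ratio a b c d)"
proof -
  have s: "{b, a, d, c} = {a, b, c, d}" "{c, d, a, b} = {a, b, c, d}" "{d, c, b, a} = {a, b, c, d}"
    by auto
  have "extreme a b c d \<Longrightarrow> R a b c d \<longleftrightarrow> Q (cross_ratio a b c d)"
    by (rule R) (use col dist in_U in auto)
  moreover have "extreme b a d c \<Longrightarrow> R b a d c \<longleftrightarrow> Q (cross_ratio b a d c)"
    by (rule R) (use col dist in_U s in auto)
  moreover have "extreme c d a b \<Longrightarrow> R c d a b \<longleftrightarrow> Q (cross_ratio c d a b)"
    by (rule R) (use col dist in_U s in auto)
  moreover have "extreme d c b a \<Longrightarrow> R d c b a \<longleftrightarrow> Q (cross_ratio d c b a)"
    by (rule R) (use col dist in_U s in auto)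
  ultimately show ?thesis
    unfolding symm_def using ex_extreme[OF col dist] cross_ratio_perm[OF col dist] by auto
qed

lemma symm_ratio_iff:
  fixes a b c d :: "'a::euclidean_space"
  assumes dim: "2 \<le> DIM('a)" and K: "convex K" and n: "0 < n"
    and pts: "{a, b, c, d} \<subseteq> interior K" "distinct [a, b, c, d]" "collinear {a, b, c, d}"
  shows "symm (ratio_eq K m n) a b c d \<longleftrightarrow> cross_ratio a b c d = of_int m / of_int n"
    and "symm (ratio_gt K m n) a b c d \<longleftrightarrow> cross_ratio a b c d > of_int m / of_int n"
proof -
  have *: "(ratio_eq K m n a b c d \<longleftrightarrow> cross_ratio a b c d = of_int m / of_int n) \<and>
      (ratio_gt K m n a b c d \<longleftrightarrow> cross_ratio a b c d > of_int m / of_int n)"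
    if abcd: "{a, b, c, d} \<subseteq> interior K" "collinear {a, b, c, d}" "distinct [a, b, c, d]" "extreme a b c d"
    for a b c d
  proof -
    obtain v \<beta> \<gamma> \<delta> where r: "v \<noteq> 0" "0 < \<beta>" "0 < \<gamma>" "0 < \<delta>" "\<beta> \<noteq> \<gamma>"
      and eq: "b = ray_pt a v \<beta>" "c = ray_pt a v \<gamma>" "d = ray_pt a v \<delta>"
      and cr: "cross_ratio a b c d = (\<delta> - \<beta>) / (\<gamma> - \<beta>)"
      using extreme_rayE[OF abcd(2-4)] .
    have i: "a \<in> interior K" "ray_pt a v \<beta> \<in> interior K" "ray_pt a v \<gamma> \<in> interior K"
      "ray_pt a v \<delta> \<in> interior K" using abcd(1) eq by auto
    show ?thesis
      unfolding cr unfolding eq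
      using ratio_eq_iff[OF dim K i(1) r(1-4) i(2-4) n r(5), of m]
        ratio_gt_iff[OF dim K i(1) r(1-4) i(2-4) n r(5), of m] by blast
  qed
  show "symm (ratio_eq K m n) a b c d \<longleftrightarrow> cross_ratio a b c d = of_int m / of_int n"
    by (rule symm_iff[OF pts(3,2,1)]) (use * in blast)
  show "symm (ratio_gt K m n) a b c d \<longleftrightarrow> cross_ratio a b c d > of_int m / of_int n"
    by (rule symm_iff[OF pts(3,2,1)]) (use * in blast)
qed

section \<open>The formulas\<close>

definition Or :: "fm \<Rightarrow> fm \<Rightarrow> fm" where
  "Or p q = Neg (Conj (Neg p) (Neg q))"

lemma sat_Or [simp]: "sat U R e (Or p q) \<longleftrightarrow> sat U R e p \<or> sat U R e q"
  by (simp add: Or_def)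

lemma fv_Or [simp]: "fv (Or p q) = fv p \<union> fv q"
  by (simp add: Or_def)

text \<open>The last argument \<open>f\<close> is a strict upper bound for the free variables; bound variables are
  taken from \<open>f\<close> on.\<close>

definition harmonic_fm :: "nat \<Rightarrow> nat \<Rightarrow> nat \<Rightarrow> nat \<Rightarrow> nat \<Rightarrow> fm" where
  "harmonic_fm c y d z f =
     Conj (B c y d) (Conj (B y d z) (Conj (Neg (Eq c y)) (Conj (Neg (Eq y d)) (Conj (Neg (Eq d z))
     (Ex f (Ex (f + 1) (Ex (f + 2) (Ex (f + 3)
       (Conj (Neg (B c f d)) (Conj (Neg (B f c d)) (Conj (Neg (B c d f))
       (Conj (B y (f + 1) f) (Conj (Neg (Eq (f + 1) y)) (Conj (Neg (Eq (f + 1) f))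
       (Conj (B d (f + 2) f) (Conj (B c (f + 3) f)
       (Conj (B c (f + 1) (f + 2)) (Conj (B d (f + 1) (f + 3)) (B (f + 3) (f + 2) z)))))))))))))))))))"

text \<open>The variables \<open>f\<close> to \<open>f + 3\<close> hold \<open>P\<close>,
  \<open>R\<close>, \<open>Q\<close>, \<open>S\<close>; assigning them leaves the arguments, all
  below \<open>f\<close>, untouched.\<close>

lemma sat_harmonic_fm [simp]:
  assumes "c < f" "y < f" "d < f" "z < f"
  shows "sat K betw e (harmonic_fm c y d z f) \<longleftrightarrow> harmonic K (e c) (e y) (e d) (e z)"
  using assms by (simp add: harmonic_fm_def harmonic_def)

lemma fv_harmonic_fm: "fv (harmonic_fm c y d z f) \<subseteq> {c, y, d, z}"
  by (auto simp: harmonic_fm_def)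

text \<open>The quantified \<open>f\<close> is the preceding term and occurs free in the recursive
  call, whose bound is therefore \<open>Suc f\<close>.\<close>

primrec chain_fm :: "nat \<Rightarrow> nat \<Rightarrow> nat \<Rightarrow> nat \<Rightarrow> nat \<Rightarrow> nat \<Rightarrow> nat \<Rightarrow> fm" where
  "chain_fm p t z 0 x y f = Conj (Eq x p) (Eq y t)"
| "chain_fm p t z (Suc n) x y f =
     Ex f (Conj (chain_fm p t z n f x (Suc f)) (harmonic_fm f x y z (Suc f)))"

lemma sat_chain_fm [simp]:
  assumes "p < f" "t < f" "z < f" "x < f" "y < f"
  shows "sat K betw e (chain_fm p t z n x y f) \<longleftrightarrow> chain K (e p) (e t) (e z) n (e x) (e y)"
  using assms by (induction n arbitrary: x y e f) simp_all

lemma fv_chain_fm: "fv (chain_fm p t z n x y f) \<subseteq> {p, t, z, x, y}"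
proof (induction n arbitrary: x y f)
  case (Suc n)
  show ?case using Suc[of f x "Suc f"] fv_harmonic_fm[of f x y z "Suc f"] by auto
qed auto

text \<open>The three successors have separate scopes, so \<open>f + 2\<close> can be
  reused.\<close>

definition net_fm :: "nat \<Rightarrow> nat \<Rightarrow> nat \<Rightarrow> nat \<Rightarrow> nat \<Rightarrow> nat \<Rightarrow> nat \<Rightarrow> nat \<Rightarrow> fm" where
  "net_fm i j k z b c d f =
     Ex f (Ex (f + 1) (Conj (B f (f + 1) z) (Conj (Neg (Eq f (f + 1))) (Conj (Neg (Eq (f + 1) z))
       (Conj (Ex (f + 2) (chain_fm f (f + 1) z i b (f + 2) (f + 3)))
       (Conj (Ex (f + 2) (chain_fm f (f + 1) z j c (f + 2) (f + 3)))
         (Ex (f + 2) (chain_fm f (f + 1) z k d (f + 2) (f + 3)))))))))"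

lemma sat_net_fm [simp]:
  assumes "z < f" "b < f" "c < f" "d < f"
  shows "sat K betw e (net_fm i j k z b c d f) \<longleftrightarrow> net K i j k (e z) (e b) (e c) (e d)"
  using assms by (simp add: net_fm_def net_def)

lemma fv_net_fm: "fv (net_fm i j k z b c d f) \<subseteq> {z, b, c, d}"
  by (simp add: net_fm_def Diff_subset_conv subset_trans[OF fv_chain_fm])

definition ratio_eq_fm :: "int \<Rightarrow> int \<Rightarrow> nat \<Rightarrow> nat \<Rightarrow> nat \<Rightarrow> nat \<Rightarrow> nat \<Rightarrow> fm" where
  "ratio_eq_fm m n a b c d f =
     Or (net_fm (nat (max 0 (- m))) (nat (max 0 (- m) + n)) (nat (max 0 (- m) + m)) a b c d f)
       (net_fm (nat (max n m)) (nat (max n m - n)) (nat (max n m - m)) a b c d f)"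

lemma sat_ratio_eq_fm [simp]:
  assumes "a < f" "b < f" "c < f" "d < f"
  shows "sat K betw e (ratio_eq_fm m n a b c d f) \<longleftrightarrow> ratio_eq K m n (e a) (e b) (e c) (e d)"
  using assms by (simp add: ratio_eq_fm_def ratio_eq_def)

lemma fv_ratio_eq_fm: "fv (ratio_eq_fm m n a b c d f) \<subseteq> {a, b, c, d}"
  by (simp add: ratio_eq_fm_def fv_net_fm)

definition ratio_gt_fm :: "int \<Rightarrow> int \<Rightarrow> nat \<Rightarrow> nat \<Rightarrow> nat \<Rightarrow> nat \<Rightarrow> nat \<Rightarrow> fm" where
  "ratio_gt_fm m n a b c d f =
     Or (Conj (B b c a)
          (Neg (Ex f (Conj (B d f a) (Conj (Neg (Eq f a)) (ratio_eq_fm m n a b c f (Suc f)))))))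
       (Conj (B c b a)
          (Ex f (Conj (B d f a) (Conj (Neg (Eq f a)) (Conj (Neg (Eq f d))
            (ratio_eq_fm m n a b c f (Suc f)))))))"

lemma sat_ratio_gt_fm [simp]:
  assumes "a < f" "b < f" "c < f" "d < f"
  shows "sat K betw e (ratio_gt_fm m n a b c d f) \<longleftrightarrow> ratio_gt K m n (e a) (e b) (e c) (e d)"
  using assms by (simp add: ratio_gt_fm_def ratio_gt_def)

lemma fv_ratio_gt_fm: "fv (ratio_gt_fm m n a b c d f) \<subseteq> {a, b, c, d}"
  by (simp add: ratio_gt_fm_def Diff_subset_conv subset_trans[OF fv_ratio_eq_fm])

definition extreme_fm :: "nat \<Rightarrow> nat \<Rightarrow> nat \<Rightarrow> nat \<Rightarrow> fm" where
  "extreme_fm a b c d = Conj (Neg (B b a c)) (Conj (Neg (B b a d)) (Neg (B c a d)))"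

text \<open>Variables 0 to 3 stand for the four points, so quantified variables start at 4.\<close>

definition symm_fm :: "(nat \<Rightarrow> nat \<Rightarrow> nat \<Rightarrow> nat \<Rightarrow> nat \<Rightarrow> fm) \<Rightarrow> fm" where
  "symm_fm \<phi> =
     Or (Conj (extreme_fm 0 1 2 3) (\<phi> 0 1 2 3 4)) (Or (Conj (extreme_fm 1 0 3 2) (\<phi> 1 0 3 2 4))
       (Or (Conj (extreme_fm 2 3 0 1) (\<phi> 2 3 0 1 4)) (Conj (extreme_fm 3 2 1 0) (\<phi> 3 2 1 0 4))))"

lemma holds4_symm_fm:
  assumes "\<And>a b c d f e. a < f \<Longrightarrow> b < f \<Longrightarrow> c < f \<Longrightarrow> d < f \<Longrightarrow>
    sat K betw e (\<phi> a b c d f) \<longleftrightarrow> R (e a) (e b) (e c) (e d)"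
  shows "holds4 K (symm_fm \<phi>) a b c d \<longleftrightarrow> symm R a b c d"
  by (simp add: holds4_def symm_fm_def symm_def assms extreme_fm_def extreme_def)

lemma fv_symm_fm:
  assumes "\<And>a b c d f. fv (\<phi> a b c d f) \<subseteq> {a, b, c, d}"
  shows "fv (symm_fm \<phi>) \<subseteq> {0, 1, 2, 3}"
  by (simp add: symm_fm_def extreme_fm_def subset_trans[OF assms])

theorem proposition9p7:
  fixes K :: "(real ^ 'n) set" and q :: rat
  assumes "CARD('n) \<ge> 2" and "convex K" and "interior K \<noteq> {}"
    and "q \<notin> {0, 1}"
  shows "\<exists>CR CRgt :: fm. fv CR \<subseteq> {0, 1, 2, 3} \<and> fv CRgt \<subseteq> {0, 1, 2, 3} \<and>
    (\<forall>a b c d. {a, b, c, d} \<subseteq> interior K \<and> distinct [a, b, c, d] \<and> collinear {a, b, c, d} \<longrightarrow>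
      (holds4 K CR a b c d \<longleftrightarrow> cross_ratio a b c d = of_rat q) \<and>
      (holds4 K CRgt a b c d \<longleftrightarrow> cross_ratio a b c d > of_rat q))"
proof -
  \<comment> \<open>The formulas are built from this fraction alone, hence uniformly in
    \<open>K\<close>; \<open>ratio_eq_iff\<close> relies on the positive denominator.\<close>
  obtain m n where mn: "quotient_of q = (m, n)" by (cases "quotient_of q")
  then have n: "0 < n" by (rule quotient_of_denom_pos)
  have "q = of_int m / of_int n" using mn by (rule quotient_of_div)
  then have q: "of_rat q = (of_int m / of_int n :: real)" by (simp add: of_rat_divide)
  have dim: "2 \<le> DIM(real ^ 'n)" using assms(1) by simp
  have eq_fm: "holds4 K (symm_fm (ratio_eq_fm m n)) a b c d \<longleftrightarrow> symm (ratio_eq K m n) a b c d" for a b c d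
    by (rule holds4_symm_fm) (rule sat_ratio_eq_fm)
  have gt_fm: "holds4 K (symm_fm (ratio_gt_fm m n)) a b c d \<longleftrightarrow> symm (ratio_gt K m n) a b c d" for a b c d
    by (rule holds4_symm_fm) (rule sat_ratio_gt_fm)
  show ?thesis
  proof (rule exI[of _ "symm_fm (ratio_eq_fm m n)"], rule exI[of _ "symm_fm (ratio_gt_fm m n)"],
      intro conjI allI impI)
    show "fv (symm_fm (ratio_eq_fm m n)) \<subseteq> {0, 1, 2, 3}"
      by (intro fv_symm_fm fv_ratio_eq_fm)
    show "fv (symm_fm (ratio_gt_fm m n)) \<subseteq> {0, 1, 2, 3}"
      by (intro fv_symm_fm fv_ratio_gt_fm)
    fix a b c d
    assume "{a, b, c, d} \<subseteq> interior K \<and> distinct [a, b, c, d] \<and> collinear {a, b, c, d}"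
    then have "{a, b, c, d} \<subseteq> interior K" "distinct [a, b, c, d]" "collinear {a, b, c, d}" by auto
    note iff = symm_ratio_iff[OF dim assms(2) n this]
    show "holds4 K (symm_fm (ratio_eq_fm m n)) a b c d \<longleftrightarrow> cross_ratio a b c d = of_rat q"
      unfolding eq_fm iff(1) q ..
    show "holds4 K (symm_fm (ratio_gt_fm m n)) a b c d \<longleftrightarrow> cross_ratio a b c d > of_rat q"
      unfolding gt_fm iff(2) q ..
  qed
qed

end
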